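(* Let $p\ge 5$ be a prime. There does not exist a regular $(8p^3,\,4p^2+2p-2,\,2p-2,\,2p+2)$-PDS in an Abelian group.
   Context: Let $G$ be a finite Abelian group of order $v$ with identity $e$, and $D\subseteq G$ a subset of size $k$. $D$ is a $(v,k,\lambda,\mu)$-partial difference set (PDS) in $G$ if the expressions $gh^{-1}$ with $g,h\in D$, $g\neq h$, represent each non-identity element of $D$ exactly $\lambda$ times and each non-identity element of $G$ not in $D$ exactly $\mu$ times. $D$ is regular if moreover $D^{(-1)}=D$ and $e\notin D$. *)

theory Defs
  imports "HOL-Algebra.Coset" "HOL-Computational_Algebra.Primes"
begin

definition is_pds ::
  "('a, 'b) monoid_scheme \<Rightarrow> nat \<Rightarrow> nat \<Rightarrow> nat \<Rightarrow> nat \<Rightarrow> 'a set \<Rightarrow> bool" where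
  "is_pds G v k l m D \<longleftrightarrow>
     finite (carrier G) \<and> order G = v \<and> D \<subseteq> carrier G \<and> card D = k \<and>
     (\<forall>x \<in> D - {\<one>\<^bsub>G\<^esub>}.
        card {(g, h). g \<in> D \<and> h \<in> D \<and> g \<noteq> h \<and> g \<otimes>\<^bsub>G\<^esub> inv\<^bsub>G\<^esub> h = x} = l) \<and>
     (\<forall>x \<in> carrier G - D - {\<one>\<^bsub>G\<^esub>}.
        card {(g, h). g \<in> D \<and> h \<in> D \<and> g \<noteq> h \<and> g \<otimes>\<^bsub>G\<^esub> inv\<^bsub>G\<^esub> h = x} = m)"

definition is_regular_pds ::
  "('a, 'b) monoid_scheme \<Rightarrow> nat \<Rightarrow> nat \<Rightarrow> nat \<Rightarrow> nat \<Rightarrow> 'a set \<Rightarrow> bool" where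
  "is_regular_pds G v k l m D \<longleftrightarrow>
     is_pds G v k l m D \<and> m_inv G ` D = D \<and> \<one>\<^bsub>G\<^esub> \<notin> D"

end

theory Submission
  imports Defs "HOL-Algebra.Sylow" "HOL-Number_Theory.Residue_Primitive_Roots"
begin

text \<open>
  The non-principal character values of \<open>D\<close> are \<open>- 2 \<plusminus> 2 p\<close>. Expanding powers of \<open>D\<close> in the group
  ring and reducing modulo a prime \<open>q\<close> gives two facts. For \<open>q\<close> prime to \<open>2 p\<close>, the set \<open>D\<close> is closed
  under \<open>q\<close>-th powers. For \<open>q = p\<close>, the image of \<open>D + 2\<close> in \<open>\<int>[G / P]\<close> is divisible by \<open>p\<close>, where
  \<open>P\<close> is the Sylow \<open>p\<close>-subgroup. Let \<open>K\<close> be the Sylow \<open>2\<close>-subgroup and let \<open>p * t h\<close> be the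
  coefficient of that image at the coset \<open>h P\<close>, for \<open>h \<in> K\<close>. Counting differences inside \<open>P\<close> yields
  \<open>\<Sum> t h = 4 p + 2\<close> and \<open>\<Sum> (t h)\<^sup>2 = 2 p\<^sup>2 + 2 p + 4\<close>, so the eight numbers \<open>t h\<close> lie within \<open>2\<close> of
  their mean \<open>(2 p + 1) / 4\<close>. On the other hand the power maps fixing \<open>K\<close> pointwise act on \<open>D\<close> and
  have orbits of length divisible by \<open>p - 1\<close> outside \<open>K\<close>, so for \<open>h \<noteq> 1\<close> each \<open>t h\<close> is \<open>0\<close> or \<open>1\<close>
  modulo \<open>p - 1\<close>. For \<open>p \<ge> 7\<close> these conditions are incompatible; for \<open>p = 5\<close> they force
  \<open>t 1 = 2\<close> and \<open>t h \<in> {1, 4}\<close> otherwise, and then the sum is wrong modulo \<open>3\<close>.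
\<close>

section \<open>Free cyclic actions and Fermat's little theorem\<close>

text \<open>Orbits of exactly \<open>n\<close> elements are split off one at a time. Injectivity of
  \<open>f\<close> on \<open>A\<close> is implicit, since the \<open>n\<close>-th iterate is the
  identity there.\<close>

lemma dvd_card_free_orbits:
  assumes "finite A" "n > 0"
    and "\<And>a. a \<in> A \<Longrightarrow> f a \<in> A"
    and "\<And>a. a \<in> A \<Longrightarrow> (f ^^ n) a = a"
    and "\<And>a i. a \<in> A \<Longrightarrow> 0 < i \<Longrightarrow> i < n \<Longrightarrow> (f ^^ i) a \<noteq> a"
  shows "n dvd card A"
  using assms(1,3,4,5)
proof (induction A rule: finite_psubset_induct)
  case (psubset A)
  show ?case
  proof (cases "A = {}")
    case False
    then obtain a where a: "a \<in> A" by auto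
    define B where "B = (\<lambda>i. (f ^^ i) a) ` {..<n}"
    have pow_in: "(f ^^ i) b \<in> A" if "b \<in> A" for i b
      using that by (induction i) (auto intro: psubset.prems(1))
    have BA: "B \<subseteq> A" using pow_in[OF a] by (auto simp: B_def)
    \<comment> \<open>Applying \<open>f\<close> another \<open>n - j\<close> times to a coincidence
      would bring \<open>a\<close> back to itself after \<open>n - j + i < n\<close> steps.\<close>
    have ne: "(f ^^ i) a \<noteq> (f ^^ j) a" if "i < j" "j < n" for i j
    proof
      assume eq: "(f ^^ i) a = (f ^^ j) a"
      have "(f ^^ (n - j + i)) a = (f ^^ (n - j)) ((f ^^ i) a)"
        by (simp add: funpow_add)
      also have "\<dots> = (f ^^ n) a"
        unfolding eq using that funpow_add[of "n - j" j f] by simp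
      finally have "(f ^^ (n - j + i)) a = a" using psubset.prems(2)[OF a] by simp
      moreover have "0 < n - j + i" "n - j + i < n" using that by auto
      ultimately show False using psubset.prems(3)[OF a] by metis
    qed
    have "inj_on (\<lambda>i. (f ^^ i) a) {..<n}"
      by (rule linorder_inj_onI) (use ne in auto)
    then have cardB: "card B = n" by (simp add: B_def card_image)
    have periodic: "(f ^^ i) a \<in> B" for i
    proof -
      have "(f ^^ i) a = (f ^^ (i mod n)) a"
        using psubset.prems(2)[OF a] by (metis funpow_mod_eq)
      then show ?thesis using assms(2) by (auto simp: B_def)
    qed
    have "n dvd card (A - B)"
    proof (rule psubset.IH)
      show "A - B \<subset> A" using a periodic[of 0] by auto
      fix b assume b: "b \<in> A - B"
      show "f b \<in> A - B"
      proof
        show "f b \<in> A" using b psubset.prems(1) by auto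
        \<comment> \<open>A further \<open>n - 1\<close> applications of \<open>f\<close> lead from
          \<open>f b\<close> back to \<open>b\<close>, so \<open>b\<close> itself would lie in the
          orbit.\<close>
        show "f b \<notin> B"
        proof
          assume "f b \<in> B"
          then obtain i where "f b = (f ^^ i) a" by (auto simp: B_def)
          then have "(f ^^ (n - 1)) (f b) = (f ^^ (n - 1 + i)) a"
            by (simp add: funpow_add)
          moreover have "(f ^^ (n - 1)) (f b) = (f ^^ n) b"
            using assms(2) by (cases n) (auto simp: funpow_swap1)
          ultimately have "b \<in> B" using psubset.prems(2)[of b] b periodic by auto
          then show False using b by auto
        qed
      qed
    qed (use psubset.prems in auto)
    moreover have "card A = n + card (A - B)"
      using card_Diff_subset[OF finite_subset[OF BA] BA] cardB psubset.hyps card_mono[OF _ BA]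
      by simp
    ultimately show ?thesis by simp
  qed simp
qed

text \<open>\<open>i\<close> is invertible modulo the prime length, so an iterate of the rotation by
  \<open>i\<close> is the rotation by one place; hence neighbouring entries agree.\<close>

lemma replicate_if_rotate_fixed:
  assumes "Factorial_Ring.prime (length xs)" "0 < i" "i < length xs" "rotate i xs = xs"
  shows "xs = replicate (length xs) (hd xs)"
proof -
  let ?q = "length xs"
  have "coprime i ?q"
    using prime_imp_coprime[OF assms(1), of i] nat_dvd_not_less[OF assms(2,3)]
    by (simp add: coprime_commute)
  from cong_solve_coprime_nat[OF this] obtain j where j: "[i * j = 1] (mod ?q)" by auto
  have "(rotate i ^^ j) xs = xs" by (induction j) (auto simp: assms(4))
  moreover have "(rotate i ^^ j) xs = rotate (i * j) xs"
    by (induction j) (auto simp: rotate_rotate algebra_simps)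
  ultimately have "rotate (i * j) xs = xs" by simp
  moreover have "rotate (i * j) xs = rotate 1 xs"
    using j rotate_conv_mod[of "i * j" xs] rotate_conv_mod[of 1 xs] by (simp add: cong_def)
  ultimately have r: "rotate1 xs = xs" by simp
  have nth: "n < ?q \<Longrightarrow> xs ! n = xs ! 0" for n
  proof (induction n)
    case (Suc n)
    then show ?case using nth_rotate1[of n xs] r by simp
  qed simp
  have "xs \<noteq> []" using assms(3) by auto
  then have "\<forall>y\<in>set xs. y = hd xs" using nth by (metis hd_conv_nth in_set_conv_nth)
  then show ?thesis using replicate_length_same by metis
qed

text \<open>This will be applied to the eigenvalues, which may be negative or divisible by
  \<open>q\<close>.\<close>

lemma fermat_little_int:
  fixes a :: int
  assumes q: "Factorial_Ring.prime q"
  shows "[a ^ q = a] (mod int q)"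
proof -
  have q0: "q > 0" using q prime_gt_0_nat by blast
  define n where "n = nat (a mod int q)"
  have n: "[int n = a] (mod int q)" using q0 by (simp add: n_def cong_def)
  have "[n ^ q = n] (mod q)"
  proof (cases "q dvd n")
    case True
    then show ?thesis using q0 dvd_trans[OF True dvd_power[of q n]] by (simp add: cong_def mod_eq_0_iff_dvd)
  next
    case False
    have "[n ^ (q - 1) * n = 1 * n] (mod q)"
      by (intro cong_mult fermat_theorem q False cong_refl)
    then show ?thesis using q0 by (simp add: power_eq_if mult.commute)
  qed
  then have "[int n ^ q = int n] (mod int q)" by (metis cong_int_iff of_nat_power)
  then show ?thesis using n by (metis cong_pow cong_sym cong_trans)
qed

section \<open>Powers of \<open>D\<close> in the group ring, counted by words\<close>

context comm_group
begin

primrec list_prod :: "'a list \<Rightarrow> 'a" where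
  "list_prod [] = \<one>"
| "list_prod (x # xs) = x \<otimes> list_prod xs"

text \<open>The cardinality is the coefficient of \<open>x\<close> in the \<open>n\<close>-th power
  of \<open>D\<close> in the group ring. Keeping the words themselves lets rotation act on
  them.\<close>

definition words :: "'a set \<Rightarrow> nat \<Rightarrow> 'a \<Rightarrow> 'a list set" where
  "words D n x = {xs. set xs \<subseteq> D \<and> length xs = n \<and> list_prod xs = x}"

lemma list_prod_closed: "set xs \<subseteq> carrier G \<Longrightarrow> list_prod xs \<in> carrier G"
  by (induction xs) auto

lemma list_prod_snoc:
  "set xs \<subseteq> carrier G \<Longrightarrow> y \<in> carrier G \<Longrightarrow> list_prod (xs @ [y]) = y \<otimes> list_prod xs"
proof (induction xs)
  case (Cons z zs)
  then show ?case using list_prod_closed[of zs] m_lcomm[of z y] by simp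
qed simp

lemma list_prod_rotate1: "set xs \<subseteq> carrier G \<Longrightarrow> list_prod (rotate1 xs) = list_prod xs"
  using list_prod_snoc by (cases xs) auto

lemma list_prod_replicate: "d \<in> carrier G \<Longrightarrow> list_prod (replicate n d) = d [^] n"
  by (induction n) (auto simp: m_comm)

lemma finite_words: "finite D \<Longrightarrow> finite (words D n x)"
  by (rule finite_subset[OF _ finite_lists_length_eq[of D n]]) (auto simp: words_def)

text \<open>Frobenius for the group ring modulo \<open>q\<close>: rotation acts freely on the non-constant words.\<close>

lemma card_words_cong_card_roots:
  assumes D: "D \<subseteq> carrier G" "finite D" and q: "Factorial_Ring.prime q"
  shows "[card (words D q x) = card {d \<in> D. d [^] q = x}] (mod q)"
proof -
  \<comment> \<open>The constant words: for prime length, only these are fixed by a nontrivial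
    rotation.\<close>
  let ?C = "(\<lambda>d. replicate q d) ` {d \<in> D. d [^] q = x}"
  let ?A = "words D q x - ?C"
  have q0: "q > 0" using q prime_gt_0_nat by blast
  have C_sub: "?C \<subseteq> words D q x"
    using D(1) q0 by (auto simp: words_def list_prod_replicate subset_iff)
  have C_iff: "xs \<in> ?C" if "xs \<in> words D q x" "xs = replicate q d" for xs d
  proof -
    have "d \<in> D" using that q0 by (auto simp: words_def)
    moreover have "d [^] q = x"
      using that D(1) \<open>d \<in> D\<close> by (auto simp: words_def list_prod_replicate subset_iff)
    ultimately show ?thesis using that by auto
  qed
  have "q dvd card ?A"
  proof (rule dvd_card_free_orbits[where f = rotate1])
    show "finite ?A" using finite_words[OF D(2)] by auto
    show "q > 0" by (rule q0)
    fix xs assume xs: "xs \<in> ?A"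
    have len: "length xs = q" using xs by (auto simp: words_def)
    have nonfixed: "rotate i xs \<noteq> xs" if "0 < i" "i < q" for i
      using replicate_if_rotate_fixed[of xs i] C_iff[of xs] xs len q that by auto
    show "(rotate1 ^^ q) xs = xs" using len by (simp flip: rotate_def)
    show "(rotate1 ^^ i) xs \<noteq> xs" if "0 < i" "i < q" for i
      using nonfixed[OF that] by (simp flip: rotate_def)
    have "rotate1 xs \<in> words D q x"
      using xs D(1) list_prod_rotate1[of xs] by (auto simp: words_def)
    moreover have "rotate1 xs \<notin> ?C"
    proof
      assume "rotate1 xs \<in> ?C"
      then obtain d where "rotate1 xs = replicate q d" by auto
      then have "set xs \<subseteq> {d}" by (metis set_rotate1 set_replicate_conv_if empty_subsetI order_refl)
      then have "xs = replicate q d" using len by (metis replicate_length_same singletonD subsetD)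
      then show False using C_iff xs by auto
    qed
    ultimately show "rotate1 xs \<in> ?A" by auto
  qed
  moreover have "card ?C = card {d \<in> D. d [^] q = x}"
    by (rule card_image) (use q0 in \<open>auto simp: inj_on_def replicate_eq_replicate\<close>)
  moreover have "card (words D q x) = card ?A + card ?C"
    using card_Diff_subset[OF finite_subset[OF C_sub] C_sub] card_mono[OF _ C_sub] finite_words[OF D(2)]
    by simp
  ultimately show ?thesis by (auto simp: cong_def)
qed

text \<open>Splitting off the first letter is multiplication by \<open>D\<close> in the group
  ring.\<close>

lemma card_words_Suc:
  assumes "D \<subseteq> carrier G" "finite D" "x \<in> carrier G"
  shows "card (words D (Suc n) x) = (\<Sum>d\<in>D. card (words D n (inv d \<otimes> x)))"
proof -
  have eq: "words D (Suc n) x = (\<Union>d\<in>D. (#) d ` words D n (inv d \<otimes> x))"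
  proof (intro equalityI subsetI)
    fix xs assume xs: "xs \<in> words D (Suc n) x"
    then obtain d ys where xs_eq: "xs = d # ys" by (cases xs) (auto simp: words_def)
    have ys: "d \<in> D" "set ys \<subseteq> D" "length ys = n" "d \<otimes> list_prod ys = x"
      using xs by (auto simp: words_def xs_eq)
    have "list_prod ys = inv d \<otimes> x"
      using ys assms(1) list_prod_closed[of ys] inv_solve_left[of "list_prod ys" d x] \<open>x \<in> carrier G\<close>
      by blast
    then show "xs \<in> (\<Union>d\<in>D. (#) d ` words D n (inv d \<otimes> x))"
      using ys by (auto simp: xs_eq words_def)
  next
    fix xs assume "xs \<in> (\<Union>d\<in>D. (#) d ` words D n (inv d \<otimes> x))"
    then obtain d ys where ys: "d \<in> D" "xs = d # ys" "ys \<in> words D n (inv d \<otimes> x)" by auto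
    have "d \<otimes> (inv d \<otimes> x) = x"
      using ys(1) assms by (simp add: subset_iff flip: m_assoc)
    then show "xs \<in> words D (Suc n) x" using ys by (auto simp: words_def)
  qed
  have "card (words D (Suc n) x) = (\<Sum>d\<in>D. card ((#) d ` words D n (inv d \<otimes> x)))"
    unfolding eq by (rule card_UN_disjoint) (use assms finite_words in auto)
  then show ?thesis by (simp add: card_image)
qed

text \<open>Since \<open>D\<close> is closed under inverses, quotients of its elements are products,
  so the PDS condition describes the square of \<open>D\<close> in the group ring.\<close>

lemma regular_pds_card_factorizations:
  assumes D: "is_regular_pds G v k l m D" and x: "x \<in> carrier G"
  shows "card {d \<in> D. inv d \<otimes> x \<in> D} = (if x = \<one> then k else if x \<in> D then l else m)"
proof -
  have sub: "D \<subseteq> carrier G" and fin: "finite D" and card: "card D = k" and sym: "m_inv G ` D = D"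
    using D by (auto simp: is_regular_pds_def is_pds_def intro: finite_subset)
  have inv_in: "inv d \<in> D" if "d \<in> D" for d using sym that by blast
  show ?thesis
  proof (cases "x = \<one>")
    case True
    then have "{d \<in> D. inv d \<otimes> x \<in> D} = D" using inv_in sub by auto
    then show ?thesis using True card by simp
  next
    case False
    let ?R = "{(g, h). g \<in> D \<and> h \<in> D \<and> g \<noteq> h \<and> g \<otimes> inv h = x}"
    \<comment> \<open>The second entry is forced: \<open>g \<otimes> inv h = x\<close> means
      \<open>inv h = inv g \<otimes> x\<close>.\<close>
    have "bij_betw (\<lambda>d. (d, inv (inv d \<otimes> x))) {d \<in> D. inv d \<otimes> x \<in> D} ?R"
    proof (rule bij_betw_byWitness[where f' = fst])
      show "(\<lambda>d. (d, inv (inv d \<otimes> x))) ` {d \<in> D. inv d \<otimes> x \<in> D} \<subseteq> ?R"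
      proof (rule image_subsetI)
        fix d assume "d \<in> {d \<in> D. inv d \<otimes> x \<in> D}"
        then have d: "d \<in> D" "inv d \<otimes> x \<in> D" by auto
        have c: "d \<in> carrier G" using d sub by auto
        have "d \<otimes> inv (inv (inv d \<otimes> x)) = x"
          using c x by (simp add: m_assoc[symmetric])
        moreover have "d \<otimes> inv d = \<one>" using c by simp
        ultimately have "d \<noteq> inv (inv d \<otimes> x)" using False by metis
        with \<open>d \<otimes> inv (inv (inv d \<otimes> x)) = x\<close> show "(d, inv (inv d \<otimes> x)) \<in> ?R"
          using d inv_in by blast
      qed
      have *: "inv g \<otimes> x = inv h" if "g \<in> D" "h \<in> D" "g \<otimes> inv h = x" for g h
      proof -
        have "g \<in> carrier G" "inv h \<in> carrier G" using that sub by auto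
        then show ?thesis using inv_solve_left[of "inv h" g x] x that(3) by simp
      qed
      show "\<forall>a\<in>?R. (fst a, inv (inv (fst a) \<otimes> x)) = a"
        using * sub by auto
      show "fst ` ?R \<subseteq> {d \<in> D. inv d \<otimes> x \<in> D}"
        using * inv_in by auto
    qed simp
    then have "card {d \<in> D. inv d \<otimes> x \<in> D} = card ?R" by (rule bij_betw_same_card)
    then show ?thesis using D False x
      by (auto simp: is_regular_pds_def is_pds_def)
  qed
qed

text \<open>The powers of \<open>D\<close> in the group ring stay in the span of \<open>1\<close>, \<open>D\<close> and \<open>G\<close>. The numbers
  \<open>r\<close> and \<open>s\<close> are the two non-principal eigenvalues, so that the coefficients \<open>a\<close> of \<open>1\<close> and \<open>b\<close> of
  \<open>D\<close> in the \<open>n\<close>-th power satisfy \<open>a + b * r = r ^ n\<close> and \<open>a + b * s = s ^ n\<close>.\<close>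

lemma regular_pds_card_words:
  fixes r s :: int
  assumes D: "is_regular_pds G v k l m D"
    and rs: "r + s = int l - int m" "r * s = int m - int k"
  shows "\<exists>b c. (r - s) * b = r ^ n - s ^ n \<and> [b = int n * r ^ (n - 1)] (mod (r - s)) \<and>
    (\<forall>x\<in>carrier G. int (card (words D n x)) =
       (r ^ n - b * r) * of_bool (x = \<one>) + b * of_bool (x \<in> D) + c)"
proof -
  have sub: "D \<subseteq> carrier G" and fin: "finite D" and card: "card D = k" and one: "\<one> \<notin> D"
    using D by (auto simp: is_regular_pds_def is_pds_def intro: finite_subset)
  show ?thesis
  proof (induction n)
    case 0
    have "words D 0 x = (if x = \<one> then {[]} else {})" for x by (auto simp: words_def)
    then show ?case by (intro exI[of _ 0]) auto
  next
    case (Suc n)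
    then obtain b c where bc: "(r - s) * b = r ^ n - s ^ n" "[b = int n * r ^ (n - 1)] (mod (r - s))"
      and N: "\<And>x. x \<in> carrier G \<Longrightarrow> int (card (words D n x)) =
         (r ^ n - b * r) * of_bool (x = \<one>) + b * of_bool (x \<in> D) + c" by auto
    \<comment> \<open>With \<open>a = r ^ n - b * r\<close>, multiplication by \<open>D\<close>
      changes the coefficient of \<open>D\<close> to \<open>a + b * (r + s)\<close>, which is
      \<open>?b\<close>.\<close>
    let ?b = "r ^ n + s * b" and ?c = "b * int m + int k * c"
    have "(r - s) * ?b = r ^ Suc n - s ^ Suc n"
    proof -
      have "(r - s) * ?b = (r - s) * r ^ n + s * ((r - s) * b)" by (simp add: algebra_simps)
      then show ?thesis unfolding bc(1) by (simp add: algebra_simps)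
    qed
    \<comment> \<open>For a prime dividing \<open>r - s\<close>, the equation for
      \<open>(r - s) * ?b\<close> does not determine \<open>?b\<close> modulo that prime; this
      congruence does.\<close>
    moreover have "[?b = int (Suc n) * r ^ (Suc n - 1)] (mod (r - s))"
    proof -
      have "[s = r] (mod (r - s))" by (simp add: cong_iff_dvd_diff dvd_diff_commute)
      then have "[r ^ n + s * b = r ^ n + r * (int n * r ^ (n - 1))] (mod (r - s))"
        using bc(2) by (intro cong_add cong_mult) auto
      also have "r ^ n + r * (int n * r ^ (n - 1)) = int (Suc n) * r ^ (Suc n - 1)"
        by (cases n) (auto simp: algebra_simps)
      finally show ?thesis .
    qed
    moreover have "int (card (words D (Suc n) x)) =
        (r ^ Suc n - ?b * r) * of_bool (x = \<one>) + ?b * of_bool (x \<in> D) + ?c" if x: "x \<in> carrier G" for x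
    proof -
      have "int (card (words D (Suc n) x)) = (\<Sum>d\<in>D. int (card (words D n (inv d \<otimes> x))))"
        using card_words_Suc[OF sub fin x] by simp
      also have "\<dots> = (\<Sum>d\<in>D. (r ^ n - b * r) * of_bool (d = x) + b * of_bool (inv d \<otimes> x \<in> D) + c)"
      proof (rule sum.cong[OF refl])
        fix d assume "d \<in> D"
        then have d: "d \<in> carrier G" using sub by auto
        have "inv d \<otimes> x = \<one> \<longleftrightarrow> d = x" using d x inv_solve_left[of \<one> d x] by auto
        then show "int (card (words D n (inv d \<otimes> x))) =
            (r ^ n - b * r) * of_bool (d = x) + b * of_bool (inv d \<otimes> x \<in> D) + c"
          using N[of "inv d \<otimes> x"] d x by simp
      qed
      also have "\<dots> = (r ^ n - b * r) * of_bool (x \<in> D) + b * int (card {d \<in> D. inv d \<otimes> x \<in> D}) + int k * c"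
      proof -
        have "(\<Sum>d\<in>D. of_bool (d = x)) = (of_bool (x \<in> D) :: int)"
          using fin by (simp add: of_bool_def sum.delta)
        moreover have "(\<Sum>d\<in>D. of_bool (inv d \<otimes> x \<in> D)) = int (card {d \<in> D. inv d \<otimes> x \<in> D})"
          using fin by (simp add: Int_def conj_commute)
        ultimately show ?thesis by (simp add: sum.distrib card flip: sum_distrib_left)
      qed
      also have "int (card {d \<in> D. inv d \<otimes> x \<in> D}) =
          - (r * s) * of_bool (x = \<one>) + (r + s) * of_bool (x \<in> D) + int m"
        using regular_pds_card_factorizations[OF D x] rs one by auto
      finally show ?thesis by (simp add: algebra_simps)
    qed
    ultimately show ?case by blast
  qed
qed

lemma regular_pds_card_roots_cong:
  fixes r s :: int
  assumes D: "is_regular_pds G v k l m D"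
    and rs: "r + s = int l - int m" "r * s = int m - int k"
    and q: "Factorial_Ring.prime q"
  obtains b c where "(r - s) * b = r ^ q - s ^ q" "[b = int q * r ^ (q - 1)] (mod (r - s))"
    "\<And>x. x \<in> carrier G \<Longrightarrow> [int (card {d \<in> D. d [^] q = x}) =
       (r ^ q - b * r) * of_bool (x = \<one>) + b * of_bool (x \<in> D) + c] (mod int q)"
proof -
  have sub: "D \<subseteq> carrier G" and fin: "finite D"
    using D by (auto simp: is_regular_pds_def is_pds_def intro: finite_subset)
  obtain b c where bc: "(r - s) * b = r ^ q - s ^ q" "[b = int q * r ^ (q - 1)] (mod (r - s))"
    and N: "\<And>x. x \<in> carrier G \<Longrightarrow> int (card (words D q x)) =
         (r ^ q - b * r) * of_bool (x = \<one>) + b * of_bool (x \<in> D) + c"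
    using regular_pds_card_words[OF D rs, of q] by auto
  show ?thesis
  proof (rule that[OF bc])
    fix x assume "x \<in> carrier G"
    from card_words_cong_card_roots[OF sub fin q, of x] N[OF this]
    show "[int (card {d \<in> D. d [^] q = x}) =
        (r ^ q - b * r) * of_bool (x = \<one>) + b * of_bool (x \<in> D) + c] (mod int q)"
      by (metis cong_int_iff cong_sym)
  qed
qed

section \<open>Power maps with coprime exponent, and multipliers of \<open>D\<close>\<close>

lemma pow_eq_if_cong:
  assumes x: "x \<in> carrier G" "x [^] (n::nat) = \<one>" and "[i = j] (mod n)"
  shows "x [^] i = x [^] (j::nat)"
proof -
  have "x [^] i = x [^] (i mod n)" for i :: nat
  proof -
    have "x [^] i = x [^] (n * (i div n) + i mod n)" by simp
    also have "\<dots> = (x [^] n) [^] (i div n) \<otimes> x [^] (i mod n)"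
      unfolding nat_pow_pow[OF x(1)] nat_pow_mult[OF x(1)] ..
    finally show ?thesis using x by simp
  qed
  then show ?thesis using assms(3) by (metis cong_def)
qed

lemma coprime_pow_inj:
  assumes "coprime q n" "x \<in> carrier G" "y \<in> carrier G" "x [^] (n::nat) = \<one>" "y [^] n = \<one>"
    and "x [^] (q::nat) = y [^] q"
  shows "x = y"
proof -
  obtain u where u: "[q * u = 1] (mod n)" using cong_solve_coprime_nat[OF assms(1)] by auto
  have "z [^] (q * u) = z" if "z \<in> carrier G" "z [^] n = \<one>" for z
    using pow_eq_if_cong[OF that u] that(1) by simp
  then show ?thesis using assms by (metis nat_pow_pow)
qed

lemma one_if_coprime_pows:
  assumes "coprime q n" "x \<in> carrier G" "x [^] (n::nat) = \<one>" "x [^] (q::nat) = \<one>"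
  shows "x = \<one>"
  using coprime_pow_inj[of q n x \<one>] assms by simp

text \<open>By Fermat, \<open>b\<close> is 1 and the coefficient of the identity is 0 modulo
  \<open>q\<close>. So the number of \<open>q\<close>-th roots of \<open>x\<close> in
  \<open>D\<close> is the indicator of \<open>D\<close> at \<open>x\<close> plus a constant
  \<open>c\<close>, and \<open>d [^] q\<close> has exactly one such root.\<close>

lemma regular_pds_prime_multiplier:
  fixes r s :: int
  assumes D: "is_regular_pds G v k l m D"
    and rs: "r + s = int l - int m" "r * s = int m - int k"
    and q: "Factorial_Ring.prime q" "\<not> q dvd v" "\<not> int q dvd r - s" and d: "d \<in> D"
  shows "d [^] q \<in> D"
proof -
  have sub: "D \<subseteq> carrier G" and fin: "finite D" and v: "order G = v" and one: "\<one> \<notin> D"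
    using D by (auto simp: is_regular_pds_def is_pds_def intro: finite_subset)
  obtain b c where bc: "(r - s) * b = r ^ q - s ^ q"
    and N: "\<And>x. x \<in> carrier G \<Longrightarrow> [int (card {d \<in> D. d [^] q = x}) =
       (r ^ q - b * r) * of_bool (x = \<one>) + b * of_bool (x \<in> D) + c] (mod int q)"
    by (rule regular_pds_card_roots_cong[OF D rs q(1)]) blast
  have cop: "coprime q v" using q by (simp add: prime_imp_coprime)
  have pv: "x [^] v = \<one>" if "x \<in> carrier G" for x
    using pow_order_eq_1[OF that] v by simp
  note fermat = fermat_little_int[OF q(1)]
  have "[(r - s) * b = (r - s) * 1] (mod int q)"
    unfolding bc using cong_diff[OF fermat[of r] fermat[of s]] by simp
  moreover have "coprime (r - s) (int q)"
    using q(1,3) by (metis coprime_commute prime_imp_coprime prime_nat_int_transfer)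
  ultimately have b1: "[b = 1] (mod int q)" using cong_mult_lcancel by blast
  have "[r ^ q - b * r = r - 1 * r] (mod int q)"
    by (intro cong_diff cong_mult fermat b1) auto
  then have a0: "[r ^ q - b * r = 0] (mod int q)" by simp
  have N': "[int (card {d \<in> D. d [^] q = x}) = of_bool (x \<in> D) + c] (mod int q)" if "x \<in> carrier G" for x
  proof -
    have "[(r ^ q - b * r) * of_bool (x = \<one>) + b * of_bool (x \<in> D) + c
        = 0 * of_bool (x = \<one>) + 1 * of_bool (x \<in> D) + c] (mod int q)"
      by (intro cong_add cong_mult a0 b1) auto
    from cong_trans[OF N[OF that] this] show ?thesis by simp
  qed
  have "d' \<noteq> \<one>" "d' \<in> carrier G" if "d' \<in> D" for d' using that sub one by auto
  \<comment> \<open>The \<open>q\<close>-th power map is injective, so the identity has no root in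
    \<open>D\<close>. Evaluating there shows that \<open>c\<close> vanishes modulo
    \<open>q\<close>.\<close>
  then have empty: "{d \<in> D. d [^] q = \<one>} = {}" using one_if_coprime_pows[OF cop _ pv] by auto
  have "[0 = c] (mod int q)" using N'[of \<one>] one unfolding empty by simp
  then have c0: "[c = 0] (mod int q)" by (rule cong_sym)
  have dG: "d \<in> carrier G" using d sub by auto
  have "{d' \<in> D. d' [^] q = d [^] q} = {d}"
    using coprime_pow_inj[OF cop _ dG pv pv[OF dG]] subsetD[OF sub] d by auto
  then have "[1 = of_bool (d [^] q \<in> D) + c] (mod int q)" using N'[of "d [^] q"] dG by simp
  then have "[1 = of_bool (d [^] q \<in> D) + 0] (mod int q)"
    using cong_trans[OF _ cong_add[OF cong_refl c0]] by blast
  then show ?thesis using prime_gt_1_nat[OF q(1)] by (cases "d [^] q \<in> D") (auto simp: cong_def)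
qed

text \<open>Prime factors of \<open>q\<close> are peeled off one by one; each inherits coprimality
  to \<open>v\<close> and \<open>r - s\<close>.\<close>

lemma regular_pds_multiplier:
  fixes r s :: int
  assumes D: "is_regular_pds G v k l m D"
    and rs: "r + s = int l - int m" "r * s = int m - int k"
    and q: "coprime q v" "coprime (int q) (r - s)" "q > 0" and d: "d \<in> D"
  shows "d [^] q \<in> D"
  using q d
proof (induction q arbitrary: d rule: less_induct)
  case (less q)
  have dG: "d \<in> carrier G" using D less.prems(4) by (auto simp: is_regular_pds_def is_pds_def)
  show ?case
  proof (cases "q = 1")
    case True
    then show ?thesis using less.prems dG by simp
  next
    case False
    then obtain p where p: "Factorial_Ring.prime p" "p dvd q" using prime_factor_nat by blast
    then obtain t where t: "q = p * t" by auto
    have "t < q" "t > 0" using t less.prems(3) prime_gt_1_nat[OF p(1)] by auto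
    moreover have "coprime t v" "coprime (int t) (r - s)" using less.prems t by auto
    ultimately have "d [^] t \<in> D" using less by blast
    moreover have "\<not> p dvd v" "\<not> int p dvd r - s"
      using less.prems t p(1) prime_gt_1_nat[OF p(1)]
      by (auto simp: prime_imp_coprime_nat coprime_absorb_left)
    ultimately have "(d [^] t) [^] p \<in> D" using regular_pds_prime_multiplier[OF D rs p(1)] by blast
    then show ?thesis using dG t by (simp add: nat_pow_pow mult.commute)
  qed
qed

end

section \<open>An exponent of order \<open>p - 1\<close> that is trivial modulo
  \<open>n\<close>\<close>

text \<open>For a primitive root \<open>g\<close> modulo \<open>p\<close>, the power
  \<open>g ^ (p ^ a)\<close> has order \<open>p - 1\<close> modulo \<open>p ^ Suc a\<close>. The
  Chinese remainder theorem combines it with the residue 1 modulo \<open>n\<close>.\<close>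

lemma teichmueller_exponent:
  fixes p n a :: nat
  assumes p: "Factorial_Ring.prime p" and n: "coprime n p"
  obtains s where "[s = 1] (mod n)" "[s ^ (p - 1) = 1] (mod n * p ^ Suc a)"
    "\<And>i. [s ^ i = 1] (mod p) \<Longrightarrow> p - 1 dvd i"
proof -
  have p1: "p > 1" using p prime_gt_1_nat by blast
  from prime_primitive_root_exists[OF p1] p obtain g where "residue_primroot p g" by auto
  then have g: "coprime p g" "ord p g = p - 1"
    using p by (auto simp: residue_primroot_def totient_prime)
  have cop: "coprime n (p ^ Suc a)" using n by simp
  obtain s where s: "[s = 1] (mod n)" "[s = g ^ (p ^ a)] (mod p ^ Suc a)"
    using binary_chinese_remainder_nat[OF cop] by blast
  show thesis
  proof (rule that)
    show "[s = 1] (mod n)" by fact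
    have "[s ^ (p - 1) = (g ^ (p ^ a)) ^ (p - 1)] (mod p ^ Suc a)"
      by (rule cong_pow[OF s(2)])
    also have "(g ^ (p ^ a)) ^ (p - 1) = g ^ totient (p ^ Suc a)"
      using totient_prime_power_Suc[OF p] by (simp flip: power_mult)
    also have "[g ^ totient (p ^ Suc a) = 1] (mod p ^ Suc a)"
      by (rule euler_theorem) (use g(1) in \<open>simp add: coprime_commute\<close>)
    finally have "[s ^ (p - 1) = 1] (mod p ^ Suc a)" .
    moreover have "[s ^ (p - 1) = 1] (mod n)" using cong_pow[OF s(1), of "p - 1"] by simp
    ultimately show "[s ^ (p - 1) = 1] (mod n * p ^ Suc a)"
      using coprime_cong_mult_nat[OF _ _ cop] by blast
    fix i assume i: "[s ^ i = 1] (mod p)"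
    have "[s = g ^ (p ^ a)] (mod p)" using cong_dvd_modulus_nat[OF s(2)] by simp
    then have "[s ^ i = (g ^ (p ^ a)) ^ i] (mod p)" by (rule cong_pow)
    with i have "[g ^ (p ^ a * i) = 1] (mod p)"
      using cong_sym cong_trans by (metis power_mult)
    then have "p - 1 dvd p ^ a * i" using ord_divides g(2) by metis
    \<comment> \<open>This is why passing from \<open>g\<close> to its \<open>p ^ a\<close>-th power
      keeps the order \<open>p - 1\<close> modulo \<open>p\<close>.\<close>
    moreover have "coprime (p - 1) (p ^ a)"
      using coprime_diff_one_left_nat[of p] p1 by simp
    ultimately show "p - 1 dvd i" using coprime_dvd_mult_right_iff by blast
  qed
qed

section \<open>Counting roots of \<open>p\<close>-power order in \<open>D\<close> modulo
  \<open>p\<close>\<close>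

context comm_group
begin

lemma pow_card_subgroup_eq_one:
  assumes "subgroup H G" "finite H" "h \<in> H"
  shows "h [^] card H = \<one>"
proof -
  interpret H: group "G\<lparr>carrier := H\<rparr>" using assms(1) by (rule subgroup_imp_group)
  have "h [^]\<^bsub>G\<lparr>carrier := H\<rparr>\<^esub> card H = \<one>\<^bsub>G\<lparr>carrier := H\<rparr>\<^esub>"
    using H.pow_order_eq_1[of h] assms by (simp add: order_def)
  then show ?thesis by (simp add: nat_pow_consistent[symmetric])
qed

text \<open>An element of order \<open>p\<close> makes the \<open>p\<close>-th power map
  non-injective, hence not surjective on a finite group.\<close>

lemma exists_non_prime_power:
  assumes fin: "finite (carrier G)" and p: "Factorial_Ring.prime p" "p dvd order G"
  obtains y where "y \<in> carrier G" "\<And>x. x \<in> carrier G \<Longrightarrow> x [^] p \<noteq> y"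
proof -
  obtain m where "order G = p ^ 1 * m" using p(2) by auto
  from sylow_thm[OF p(1) is_group this fin] obtain H where H: "subgroup H G" "card H = p" by auto
  have finH: "finite H" using subgroup.subset[OF H(1)] fin finite_subset by blast
  have "card H > 1" using H(2) p(1) prime_gt_1_nat by blast
  then have "\<not> H \<subseteq> {\<one>}" using card_mono[of "{\<one>}" H] by auto
  then obtain h where h: "h \<in> H" "h \<noteq> \<one>" by blast
  have hG: "h \<in> carrier G" using h(1) subgroup.subset[OF H(1)] by blast
  have hp: "h [^] p = \<one> [^] p" using pow_card_subgroup_eq_one[OF H(1) finH h(1)] H(2) by simp
  let ?f = "\<lambda>x. x [^] p"
  have "\<not> inj_on ?f (carrier G)" using inj_onD[of ?f "carrier G" h \<one>] hp h(2) hG by blast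
  then have "?f ` carrier G \<noteq> carrier G" using fin by (metis eq_card_imp_inj_on)
  moreover have "?f ` carrier G \<subseteq> carrier G" by auto
  ultimately obtain y where "y \<in> carrier G" "y \<notin> ?f ` carrier G" by blast
  then show thesis using that by blast
qed

text \<open>As \<open>p\<close> divides \<open>r - s\<close>, the coefficient \<open>b\<close>
  vanishes modulo \<open>p\<close>. The constant \<open>c\<close> vanishes too, as seen at an
  element that has no \<open>p\<close>-th root at all.\<close>

lemma regular_pds_card_prime_roots:
  fixes r s :: int
  assumes D: "is_regular_pds G v k l m D"
    and rs: "r + s = int l - int m" "r * s = int m - int k"
    and p: "Factorial_Ring.prime p" "p dvd v" "int p dvd r - s" and x: "x \<in> carrier G"
  shows "[int (card {d \<in> D. d [^] p = x}) = r * of_bool (x = \<one>)] (mod int p)"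
proof -
  have sub: "D \<subseteq> carrier G" and fin: "finite (carrier G)" and v: "order G = v" and one: "\<one> \<notin> D"
    using D by (auto simp: is_regular_pds_def is_pds_def)
  obtain b c where b: "[b = int p * r ^ (p - 1)] (mod (r - s))"
    and N: "\<And>x. x \<in> carrier G \<Longrightarrow> [int (card {d \<in> D. d [^] p = x}) =
       (r ^ p - b * r) * of_bool (x = \<one>) + b * of_bool (x \<in> D) + c] (mod int p)"
    by (rule regular_pds_card_roots_cong[OF D rs p(1)]) blast
  have "[b = int p * r ^ (p - 1)] (mod int p)" using b p(3) by (rule cong_dvd_modulus)
  also have "[int p * r ^ (p - 1) = 0] (mod int p)" by (simp add: cong_0_iff)
  finally have b0: "[b = 0] (mod int p)" .
  have N': "[int (card {d \<in> D. d [^] p = x}) = r * of_bool (x = \<one>) + c] (mod int p)"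
    if "x \<in> carrier G" for x
  proof -
    have "[(r ^ p - b * r) * of_bool (x = \<one>) + b * of_bool (x \<in> D) + c
        = (r - 0 * r) * of_bool (x = \<one>) + 0 * of_bool (x \<in> D) + c] (mod int p)"
      by (intro cong_add cong_mult cong_diff b0 fermat_little_int p(1) cong_refl)
    from cong_trans[OF N[OF that] this] show ?thesis by simp
  qed
  obtain y where y: "y \<in> carrier G" "\<And>x. x \<in> carrier G \<Longrightarrow> x [^] p \<noteq> y"
    using exists_non_prime_power[OF fin p(1)] p(2) v by metis
  have empty: "{d \<in> D. d [^] p = y} = {}" using y(2) sub by auto
  have "y \<noteq> \<one>" using y(2)[of \<one>] by auto
  then have "[0 = c] (mod int p)" using N'[OF y(1)] unfolding empty by simp
  then have "[c = 0] (mod int p)" by (rule cong_sym)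
  from cong_trans[OF N'[OF x] cong_add[OF cong_refl this]] show ?thesis by simp
qed

text \<open>The roots are sorted by their \<open>p\<close>-th power \<open>y\<close>. Modulo
  \<open>p\<close> only \<open>y = \<one>\<close> contributes, and it occurs only for
  \<open>x = \<one>\<close>.\<close>

lemma card_prime_power_roots_cong:
  fixes r :: int
  assumes D: "D \<subseteq> carrier G" and fin: "finite (carrier G)"
    and roots: "\<And>x. x \<in> carrier G \<Longrightarrow>
      [int (card {d \<in> D. d [^] p = x}) = r * of_bool (x = \<one>)] (mod int p)"
  shows "[int (card {d \<in> D. d [^] (p ^ Suc a) = x}) = r * of_bool (x = \<one>)] (mod int p)"
proof -
  let ?Y = "{y \<in> carrier G. y [^] (p ^ a) = x}"
  have finD: "finite D" using D fin finite_subset by blast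
  have eq: "{d \<in> D. d [^] (p ^ Suc a) = x} = (\<Union>y\<in>?Y. {d \<in> D. d [^] p = y})"
    using D by (auto simp: nat_pow_pow subset_iff)
  have "card {d \<in> D. d [^] (p ^ Suc a) = x} = (\<Sum>y\<in>?Y. card {d \<in> D. d [^] p = y})"
    unfolding eq by (rule card_UN_disjoint) (use fin finD in auto)
  then have "int (card {d \<in> D. d [^] (p ^ Suc a) = x}) = (\<Sum>y\<in>?Y. int (card {d \<in> D. d [^] p = y}))"
    by simp
  also have "[(\<Sum>y\<in>?Y. int (card {d \<in> D. d [^] p = y})) = (\<Sum>y\<in>?Y. r * of_bool (y = \<one>))] (mod int p)"
    by (intro cong_sum roots) auto
  also have "(\<Sum>y\<in>?Y. r * of_bool (y = \<one>)) = r * of_bool (\<one> \<in> ?Y)"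
  proof -
    have "(\<Sum>y\<in>?Y. of_bool (y = \<one>)) = (of_bool (\<one> \<in> ?Y) :: int)"
      using fin by (simp add: of_bool_def)
    then show ?thesis by (simp flip: sum_distrib_left)
  qed
  also have "\<one> \<in> ?Y \<longleftrightarrow> x = \<one>" by auto
  finally show ?thesis .
qed

end

section \<open>The factorization of \<open>G\<close> by \<open>K\<close> and \<open>P\<close>, and
  the coset counts of \<open>D\<close>\<close>

text \<open>In the application \<open>K\<close> and \<open>P\<close> are the Sylow subgroups for 2
  and \<open>p\<close>; the elements of \<open>K\<close> represent the cosets of
  \<open>P\<close>.\<close>

locale coprime_factorization = comm_group +
  fixes K P :: "'a set"
  assumes fin: "finite (carrier G)" and K: "subgroup K G" and P: "subgroup P G"
    and coprime_cards: "coprime (card K) (card P)" and order_eq: "order G = card K * card P"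
begin

lemma K_sub: "h \<in> K \<Longrightarrow> h \<in> carrier G" and P_sub: "x \<in> P \<Longrightarrow> x \<in> carrier G"
  using subgroup.subset[OF K] subgroup.subset[OF P] by auto

lemma finite_K: "finite K" and finite_P: "finite P"
  using fin subgroup.subset[OF K] subgroup.subset[OF P] finite_subset by auto

lemma pow_card_K: "h \<in> K \<Longrightarrow> h [^] card K = \<one>"
  using pow_card_subgroup_eq_one[OF K finite_K] .

lemma pow_card_P: "x \<in> P \<Longrightarrow> x [^] card P = \<one>"
  using pow_card_subgroup_eq_one[OF P finite_P] .

text \<open>Raising to the power \<open>card P\<close> kills the part in \<open>P\<close> and is
  injective on \<open>K\<close>.\<close>

lemma mult_inject:
  assumes "h \<in> K" "h' \<in> K" "x \<in> P" "x' \<in> P" "h \<otimes> x = h' \<otimes> x'"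
  shows "h = h'"
proof -
  have "(h \<otimes> x) [^] card P = h [^] card P" "(h' \<otimes> x') [^] card P = h' [^] card P"
    using assms(1-4) K_sub P_sub pow_card_P by (simp_all add: nat_pow_distrib)
  then have "h [^] card P = h' [^] card P" using assms(5) by simp
  then show ?thesis
    using coprime_pow_inj[of "card P" "card K" h h'] coprime_cards assms(1,2) K_sub pow_card_K
    by (simp add: coprime_commute)
qed

lemma decompose:
  assumes "g \<in> carrier G"
  obtains h x where "h \<in> K" "x \<in> P" "g = h \<otimes> x"
proof -
  let ?f = "\<lambda>(h, x). h \<otimes> x"
  have "inj_on ?f (K \<times> P)"
  proof (rule inj_onI, clarify)
    fix h x h' x' assume a: "h \<in> K" "x \<in> P" "h' \<in> K" "x' \<in> P" "h \<otimes> x = h' \<otimes> x'"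
    then have "h = h'" using mult_inject by blast
    then show "h = h' \<and> x = x'" using a K_sub P_sub by simp
  qed
  then have "card (?f ` (K \<times> P)) = card (carrier G)"
    using order_eq by (simp add: card_image card_cartesian_product order_def)
  moreover have "?f ` (K \<times> P) \<subseteq> carrier G" using K_sub P_sub by auto
  ultimately have "?f ` (K \<times> P) = carrier G" using fin card_subset_eq by blast
  then have "g \<in> ?f ` (K \<times> P)" using assms by simp
  then show thesis using that by auto
qed

text \<open>Cosets of \<open>P\<close> are fibres of a power map, which turns root counts into coset
  counts.\<close>

lemma l_coset_eq_pow:
  assumes "h \<in> K"
  shows "h <# P = {g \<in> carrier G. g [^] card P = h [^] card P}"
proof (intro equalityI subsetI)
  fix g assume "g \<in> h <# P"
  then obtain x where x: "x \<in> P" "g = h \<otimes> x" by (auto simp: l_coset_def)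
  then show "g \<in> {g \<in> carrier G. g [^] card P = h [^] card P}"
    using assms K_sub P_sub pow_card_P by (simp add: nat_pow_distrib)
next
  fix g assume g: "g \<in> {g \<in> carrier G. g [^] card P = h [^] card P}"
  then obtain h' x where x: "h' \<in> K" "x \<in> P" "g = h' \<otimes> x" using decompose by blast
  have "h' [^] card P = h [^] card P"
    using g x K_sub P_sub pow_card_P by (simp add: nat_pow_distrib)
  then have "h' = h"
    using coprime_pow_inj[of "card P" "card K" h' h] coprime_cards assms x(1) K_sub pow_card_K
    by (simp add: coprime_commute)
  then show "g \<in> h <# P" using x by (auto simp: l_coset_def)
qed

lemma l_cosets_disjoint:
  assumes "h \<in> K" "h' \<in> K" "h \<noteq> h'"
  shows "(h <# P) \<inter> (h' <# P) = {}"
  using assms mult_inject by (fastforce simp: l_coset_def)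

lemma card_eq_sum_cosets:
  assumes "D \<subseteq> carrier G"
  shows "card D = (\<Sum>h\<in>K. card (D \<inter> (h <# P)))"
proof -
  have "D = (\<Union>h\<in>K. D \<inter> (h <# P))"
    using assms by (fastforce simp: l_coset_def elim: decompose)
  then have "card D = card (\<Union>h\<in>K. D \<inter> (h <# P))" by simp
  also have "\<dots> = (\<Sum>h\<in>K. card (D \<inter> (h <# P)))"
  proof (rule card_UN_disjoint)
    show "\<forall>h\<in>K. finite (D \<inter> (h <# P))" using assms fin finite_subset by blast
    show "\<forall>h\<in>K. \<forall>h'\<in>K. h \<noteq> h' \<longrightarrow> D \<inter> (h <# P) \<inter> (D \<inter> (h' <# P)) = {}"
      using l_cosets_disjoint by blast
  qed (rule finite_K)
  finally show ?thesis .
qed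

lemma pairs_in_common_coset:
  assumes "D \<subseteq> carrier G"
  shows "{(g, g'). g \<in> D \<and> g' \<in> D \<and> g \<otimes> inv g' \<in> P}
    = (\<Union>h\<in>K. (D \<inter> (h <# P)) \<times> (D \<inter> (h <# P)))" (is "?R = ?U")
proof (intro equalityI subsetI)
  fix u assume "u \<in> ?R"
  then obtain g g' where u: "u = (g, g')" "g \<in> D" "g' \<in> D" "g \<otimes> inv g' \<in> P" by auto
  have G: "g \<in> carrier G" "g' \<in> carrier G" using u assms by auto
  obtain h x where hx: "h \<in> K" "x \<in> P" "g' = h \<otimes> x" using decompose[OF G(2)] .
  have "g = g' \<otimes> (g \<otimes> inv g')" using G m_lcomm[of g' g "inv g'"] by simp
  also have "\<dots> = h \<otimes> (x \<otimes> (g \<otimes> inv g'))" using hx G K_sub P_sub by (simp add: m_assoc)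
  finally have "g \<in> h <# P"
    using subgroup.m_closed[OF P hx(2) u(4)] by (auto simp: l_coset_def)
  moreover have "g' \<in> h <# P" using hx by (auto simp: l_coset_def)
  ultimately show "u \<in> ?U" using u hx(1) by blast
next
  fix u assume "u \<in> ?U"
  then obtain h g g' where u: "u = (g, g')" "g \<in> D" "g' \<in> D" "h \<in> K" "g \<in> h <# P" "g' \<in> h <# P"
    by blast
  then obtain x x' where x: "x \<in> P" "g = h \<otimes> x" "x' \<in> P" "g' = h \<otimes> x'"
    by (auto simp: l_coset_def)
  have G: "h \<in> carrier G" "x \<in> carrier G" "x' \<in> carrier G" using u x K_sub P_sub by auto
  have "g \<otimes> inv g' = (h \<otimes> inv h) \<otimes> (x \<otimes> inv x')"
    unfolding x using G by (simp only: inv_mult m_ac inv_closed m_closed)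
  also have "\<dots> = x \<otimes> inv x'" using G by simp
  finally have "g \<otimes> inv g' \<in> P"
    using subgroup.m_closed[OF P x(1) subgroup.m_inv_closed[OF P x(3)]] by simp
  then show "u \<in> ?R" using u by auto
qed

text \<open>Pairs in \<open>D\<close> with quotient in \<open>P\<close> are counted twice: by their
  common coset, and by the quotient \<open>z\<close>, which occurs \<open>k\<close>,
  \<open>l\<close> or \<open>m\<close> times.\<close>

lemma regular_pds_sum_squares_cosets:
  assumes D: "is_regular_pds G v k l m D"
  shows "(\<Sum>h\<in>K. int (card (D \<inter> (h <# P))) ^ 2)
    = int k + int l * int (card (D \<inter> P)) + int m * (int (card P) - 1 - int (card (D \<inter> P)))"
proof -
  have sub: "D \<subseteq> carrier G" and card: "card D = k" and one: "\<one> \<notin> D"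
    using D by (auto simp: is_regular_pds_def is_pds_def)
  have finD: "finite D" using sub fin finite_subset by blast
  define R where "R z = {(g, g'). g \<in> D \<and> g' \<in> D \<and> g \<otimes> inv g' = z}" for z
  have finR: "finite (R z)" for z
    by (rule finite_subset[of _ "D \<times> D"]) (use finD in \<open>auto simp: R_def\<close>)
  have R_one: "card (R \<one>) = k"
  proof -
    have "R \<one> = (\<lambda>g. (g, g)) ` D"
    proof -
      have "g = g'" if "g \<in> D" "g' \<in> D" "g \<otimes> inv g' = \<one>" for g g'
        using that sub by (metis inv_closed inv_equality inv_inv subsetD)
      then show ?thesis using sub by (auto simp: R_def)
    qed
    then show ?thesis using card by (simp add: card_image inj_on_def)
  qed
  have R_ne: "card (R z) = (if z \<in> D then l else m)" if "z \<in> P - {\<one>}" for z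
  proof -
    have "R z = {(g, h). g \<in> D \<and> h \<in> D \<and> g \<noteq> h \<and> g \<otimes> inv h = z}"
      using that sub by (auto simp: R_def)
    moreover have "z \<in> carrier G" "z \<noteq> \<one>" using that P_sub by auto
    ultimately show ?thesis using D by (auto simp: is_regular_pds_def is_pds_def)
  qed
  have one_P: "\<one> \<in> P" by (rule subgroup.one_closed[OF P])
  have "card (\<Union>h\<in>K. (D \<inter> (h <# P)) \<times> (D \<inter> (h <# P)))
      = (\<Sum>h\<in>K. card ((D \<inter> (h <# P)) \<times> (D \<inter> (h <# P))))"
    by (rule card_UN_disjoint) (use finite_K finD l_cosets_disjoint in \<open>blast+\<close>)
  then have "(\<Sum>h\<in>K. int (card (D \<inter> (h <# P))) ^ 2)
      = int (card (\<Union>h\<in>K. (D \<inter> (h <# P)) \<times> (D \<inter> (h <# P))))"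
    by (simp add: card_cartesian_product power2_eq_square)
  also have "(\<Union>h\<in>K. (D \<inter> (h <# P)) \<times> (D \<inter> (h <# P))) = (\<Union>z\<in>P. R z)"
    unfolding pairs_in_common_coset[OF sub, symmetric] by (auto simp: R_def)
  also have "card (\<Union>z\<in>P. R z) = (\<Sum>z\<in>P. card (R z))"
    by (rule card_UN_disjoint) (use finite_P finR in \<open>auto simp: R_def\<close>)
  also have "\<dots> = k + (\<Sum>z\<in>P - {\<one>}. card (R z))"
    using sum.remove[OF finite_P one_P, of "\<lambda>z. card (R z)"] R_one by simp
  also have "(\<Sum>z\<in>P - {\<one>}. card (R z)) = (\<Sum>z\<in>P - {\<one>}. if z \<in> D then l else m)"
    using R_ne by (intro sum.cong) auto
  also have "\<dots> = l * card ((P - {\<one>}) \<inter> D) + m * card ((P - {\<one>}) - D)"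
    using finite_P by (simp add: sum.If_cases Diff_eq mult.commute)
  also have "(P - {\<one>}) \<inter> D = D \<inter> P" using one by auto
  finally have "(\<Sum>h\<in>K. int (card (D \<inter> (h <# P))) ^ 2)
      = int k + int l * int (card (D \<inter> P)) + int m * int (card ((P - {\<one>}) - D))" by simp
  moreover have "int (card ((P - {\<one>}) - D)) = int (card P) - 1 - int (card (D \<inter> P))"
  proof -
    have "P = insert \<one> ((D \<inter> P) \<union> ((P - {\<one>}) - D))" using one_P one by auto
    also have "card \<dots> = Suc (card ((D \<inter> P) \<union> ((P - {\<one>}) - D)))"
      using one finite_P finD by (subst card_insert_disjoint) auto
    also have "card ((D \<inter> P) \<union> ((P - {\<one>}) - D)) = card (D \<inter> P) + card ((P - {\<one>}) - D)"
      using finite_P finD by (intro card_Un_disjoint) auto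
    finally show ?thesis by simp
  qed
  ultimately show ?thesis by simp
qed

text \<open>Raising to the power \<open>s\<close> acts freely with order \<open>p - 1\<close> on the elements of the coset \<open>h P\<close>
  other than \<open>h\<close>.\<close>

lemma card_coset_cong_pred_prime:
  assumes D: "D \<subseteq> carrier G" and p: "Factorial_Ring.prime p" "card P = p ^ a"
    and s: "[s = 1] (mod card K)" "[s ^ (p - 1) = 1] (mod order G)"
      "\<And>i. [s ^ i = 1] (mod p) \<Longrightarrow> p - 1 dvd i"
    and closed: "\<And>d. d \<in> D \<Longrightarrow> d [^] s \<in> D" and h: "h \<in> K"
  shows "[int (card (D \<inter> (h <# P))) = of_bool (h \<in> D)] (mod int (p - 1))"
proof -
  let ?A = "D \<inter> (h <# P) - {h}"
  have p1: "p > 1" using p(1) prime_gt_1_nat by blast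
  have hG: "h \<in> carrier G" using h K_sub by simp
  have pow_h: "h [^] i = h" if "[i = 1] (mod card K)" for i :: nat
    using pow_eq_if_cong[OF hG pow_card_K[OF h] that] hG by simp
  have si: "[s ^ i = 1] (mod card K)" for i using cong_pow[OF s(1), of i] by simp
  have funpow: "((\<lambda>g. g [^] s) ^^ i) g = g [^] (s ^ i)" if "g \<in> carrier G" for i g
    using that by (induction i) (auto simp: nat_pow_pow mult.commute)
  have A: "\<exists>x\<in>P. x \<noteq> \<one> \<and> g = h \<otimes> x" if "g \<in> ?A" for g
  proof -
    from that obtain x where "x \<in> P" "g = h \<otimes> x" "g \<noteq> h" by (auto simp: l_coset_def)
    moreover from this have "x \<noteq> \<one>" using hG by auto
    ultimately show ?thesis by blast
  qed
  \<comment> \<open>Otherwise \<open>s ^ i - 1\<close> would be coprime to \<open>card P\<close> and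
    yet kill \<open>x\<close>.\<close>
  have nonfixed: "[s ^ i = 1] (mod p)" if x: "x \<in> P" "x \<noteq> \<one>" "x [^] (s ^ i) = x" for x i
  proof (rule ccontr)
    assume nc: "\<not> [s ^ i = 1] (mod p)"
    have xG: "x \<in> carrier G" using x(1) P_sub by simp
    show False
    \<comment> \<open>The natural subtraction \<open>s ^ i - 1\<close> must not truncate, so a zero
      power is excluded first.\<close>
    proof (cases "s = 0 \<and> i > 0")
      case True
      then show False using x xG by (simp add: zero_power)
    next
      case False
      then have pos: "s ^ i \<ge> 1" by auto
      have "x \<otimes> x [^] (s ^ i - 1) = x [^] (1 + (s ^ i - 1))"
        using nat_pow_mult[OF xG, of 1 "s ^ i - 1"] xG by simp
      also have "1 + (s ^ i - 1) = s ^ i" using pos by simp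
      finally have "x \<otimes> x [^] (s ^ i - 1) = x \<otimes> \<one>" using x(3) xG by simp
      then have e: "x [^] (s ^ i - 1) = \<one>" using xG by simp
      have "\<not> p dvd s ^ i - 1" using nc pos by (metis cong_altdef_nat)
      then have "coprime p (s ^ i - 1)" using prime_imp_coprime[OF p(1)] by blast
      then have "coprime (s ^ i - 1) (card P)" using p(2) by (simp add: coprime_commute)
      then show False using one_if_coprime_pows[OF _ xG pow_card_P[OF x(1)] e] x(2) by blast
    qed
  qed
  have "p - 1 dvd card ?A"
  proof (rule dvd_card_free_orbits[where f = "\<lambda>g. g [^] s"])
    show "finite ?A" using D fin finite_subset by blast
    show "p - 1 > 0" using p1 by simp
    fix g assume g: "g \<in> ?A"
    have gG: "g \<in> carrier G" using g D by auto
    obtain x where x: "x \<in> P" "x \<noteq> \<one>" "g = h \<otimes> x" using A[OF g] by blast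
    have xG: "x \<in> carrier G" using x(1) P_sub by simp
    have g_pow: "g [^] (s ^ i) = h \<otimes> x [^] (s ^ i)" for i
      unfolding x(3) using hG xG pow_h[OF si] by (simp add: nat_pow_distrib)
    show periodic: "((\<lambda>g. g [^] s) ^^ (p - 1)) g = g"
      using funpow[OF gG] pow_eq_if_cong[OF gG pow_order_eq_1[OF gG] s(2)] gG by simp
    show "((\<lambda>g. g [^] s) ^^ i) g \<noteq> g" if i: "0 < i" "i < p - 1" for i
    proof
      assume "((\<lambda>g. g [^] s) ^^ i) g = g"
      then have "h \<otimes> x [^] (s ^ i) = h \<otimes> x" using funpow[OF gG] g_pow x(3) by simp
      then have "x [^] (s ^ i) = x" using hG xG by simp
      then have "p - 1 dvd i" using nonfixed x s(3) by blast
      then show False using i by (simp add: nat_dvd_not_less)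
    qed
    have "g [^] s = h \<otimes> x [^] s" using g_pow[of 1] by simp
    moreover have "x [^] s \<in> P" using x(1) by (induction s) (auto simp: subgroup.one_closed[OF P] subgroup.m_closed[OF P])
    ultimately have "g [^] s \<in> h <# P" by (auto simp: l_coset_def)
    \<comment> \<open>Powers of \<open>s\<close> fix \<open>h\<close>, so from \<open>h\<close> the
      orbit could not return to \<open>g\<close>.\<close>
    moreover have "g [^] s \<noteq> h"
    proof
      assume "g [^] s = h"
      then have "g [^] (s ^ (p - 1)) = h [^] (s ^ (p - 1 - 1))"
        using gG p1 by (metis Suc_diff_1 nat_pow_pow power_Suc zero_less_diff)
      then have "g = h" using periodic funpow[OF gG] pow_h[OF si] by simp
      then show False using g by simp
    qed
    ultimately show "g [^] s \<in> ?A" using closed g by blast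
  qed
  then have "[int (card ?A) = 0] (mod int (p - 1))" by (simp add: cong_0_iff)
  moreover have "int (card (D \<inter> (h <# P))) = of_bool (h \<in> D) + int (card ?A)"
  proof -
    have "finite (D \<inter> (h <# P))" using D fin finite_subset by blast
    moreover have "h \<in> h <# P" using subgroup.one_closed[OF P] hG by (force simp: l_coset_def)
    ultimately show ?thesis using card.remove[of "D \<inter> (h <# P)" h] by (cases "h \<in> D") simp_all
  qed
  ultimately show ?thesis by (simp add: cong_iff_dvd_diff)
qed

end

section \<open>The arithmetic contradiction\<close>

lemma no_coset_profile:
  fixes t :: "'a \<Rightarrow> int" and p :: nat
  assumes p: "Factorial_Ring.prime p" "p \<ge> 5" and K: "finite K" "card K = 8" "e \<in> K"
    and sum: "(\<Sum>h\<in>K. t h) = 4 * int p + 2"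
    and sum_sq: "(\<Sum>h\<in>K. t h ^ 2) = 2 * int p ^ 2 + 2 * int p + 4"
    and e: "[t e = 2] (mod int (p - 1))"
    and cong: "\<And>h. h \<in> K \<Longrightarrow> h \<noteq> e \<Longrightarrow> [t h = 0] (mod int (p - 1)) \<or> [t h = 1] (mod int (p - 1))"
  shows False
proof -
  \<comment> \<open>The mean of the eight numbers is \<open>(2 * p + 1) / 4\<close>; the factor 4
    keeps the deviations integral.\<close>
  have "(\<Sum>h\<in>K. (4 * t h - (2 * int p + 1)) ^ 2)
      = (\<Sum>h\<in>K. 16 * t h ^ 2 - 8 * (2 * int p + 1) * t h + (2 * int p + 1) ^ 2)"
    by (intro sum.cong) (auto simp: power2_eq_square algebra_simps)
  also have "\<dots> = 16 * (\<Sum>h\<in>K. t h ^ 2) - 8 * (2 * int p + 1) * (\<Sum>h\<in>K. t h) + 8 * (2 * int p + 1) ^ 2"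
    using K by (simp add: sum.distrib sum_subtractf flip: sum_distrib_left)
  also have "\<dots> = 56" unfolding sum sum_sq by (simp add: power2_eq_square algebra_simps)
  finally have var: "(\<Sum>h\<in>K. (4 * t h - (2 * int p + 1)) ^ 2) = 56" .
  have bound: "\<bar>4 * t h - (2 * int p + 1)\<bar> \<le> 7" if "h \<in> K" for h
  proof -
    have "(4 * t h - (2 * int p + 1)) ^ 2 \<le> 56"
      unfolding var[symmetric] using K that by (intro member_le_sum) auto
    then have "\<bar>4 * t h - (2 * int p + 1)\<bar> ^ 2 < 8 ^ 2" by simp
    then have "\<bar>4 * t h - (2 * int p + 1)\<bar> < 8" by (rule power_less_imp_less_base) simp
    then show ?thesis by simp
  qed
  have int_p1: "int (p - 1) = int p - 1" using p(2) by simp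
  have ne: "K - {e} \<noteq> {}"
  proof
    assume "K - {e} = {}"
    then have "card K \<le> card {e}" by (intro card_mono) auto
    then show False using K by simp
  qed
  show False
  proof (cases "p = 5")
    case True
    \<comment> \<open>Only 1 and 4 survive, both 1 modulo 3, so seven of them sum to 1 modulo 3; but
      the required sum is \<open>22 - 2 = 20\<close>.\<close>
    have "[t h = 1] (mod 3)" if "h \<in> K - {e}" for h
    proof -
      have "t h \<in> {1, 2, 3, 4}" using bound[of h] that True by auto
      moreover have "[t h = 0] (mod 4) \<or> [t h = 1] (mod 4)" using cong[of h] that True by simp
      ultimately show ?thesis by (auto simp: cong_def)
    qed
    then have "[(\<Sum>h\<in>K - {e}. t h) = (\<Sum>h\<in>K - {e}. 1)] (mod 3)" by (intro cong_sum) auto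
    then have "[(\<Sum>h\<in>K - {e}. t h) = 7] (mod 3)" using K by simp
    moreover have "t e = 2"
    proof -
      have "t e \<in> {1, 2, 3, 4}" using bound[of e] K True by auto
      then show ?thesis using e True by (auto simp: cong_def)
    qed
    ultimately show False
      using sum sum.remove[OF K(1,3), of t] True by (simp add: cong_def)
  next
    case False
    have "p \<noteq> 6" using p(1) by (auto dest: prime_odd_nat)
    with False p(2) have p7: "int p \<ge> 7" by simp
    obtain h where h: "h \<in> K" "h \<noteq> e" using ne by auto
    \<comment> \<open>From \<open>p \<ge> 7\<close> on, these bounds put \<open>t h\<close> strictly
      between 1 and \<open>p - 1\<close>, so its residue is neither 0 nor 1.\<close>
    have "4 * t h \<ge> 2 * int p - 6" "4 * t h \<le> 2 * int p + 8" using bound[OF h(1)] by auto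
    then have "t h > 1" "t h < int p - 1" using p7 by auto
    then have "t h mod (int p - 1) = t h" "1 mod (int p - 1) = 1" using p7 by auto
    then show False using cong[OF h] \<open>t h > 1\<close> int_p1 by (auto simp: cong_def)
  qed
qed

section \<open>The given parameters\<close>

theorem theorem1:
  fixes p :: nat and G :: "('a, 'b) monoid_scheme"
  assumes "Factorial_Ring.prime p" and "p \<ge> 5" and "comm_group G"
  shows "\<not> (\<exists>D. is_regular_pds G (8 * p ^ 3) (4 * p ^ 2 + 2 * p - 2) (2 * p - 2) (2 * p + 2) D)"
proof
  assume "\<exists>D. is_regular_pds G (8 * p ^ 3) (4 * p ^ 2 + 2 * p - 2) (2 * p - 2) (2 * p + 2) D"
  then obtain D where D: "is_regular_pds G (8 * p ^ 3) (4 * p ^ 2 + 2 * p - 2) (2 * p - 2) (2 * p + 2) D"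
    by blast
  interpret comm_group G by fact
  note p = assms(1,2)
  have fin: "finite (carrier G)" and ord: "order G = 8 * p ^ 3" and sub: "D \<subseteq> carrier G"
    and card_D: "card D = 4 * p ^ 2 + 2 * p - 2" and one: "\<one>\<^bsub>G\<^esub> \<notin> D"
    using D by (auto simp: is_regular_pds_def is_pds_def)
  have int_l: "int (2 * p - 2) = 2 * int p - 2" using p(2) by simp
  have int_k: "int (4 * p ^ 2 + 2 * p - 2) = 4 * int p ^ 2 + 2 * int p - 2"
    using p(2) by (simp add: of_nat_diff)
  \<comment> \<open>The roots of \<open>X^2 - (l - m) X - (k - m)\<close>, that is, of
    \<open>X^2 + 4 X - (4 p^2 - 4)\<close>.\<close>
  define r s where "r = 2 * int p - 2" and "s = - 2 * int p - 2"
  have rs: "r + s = int (2 * p - 2) - int (2 * p + 2)"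
    "r * s = int (2 * p + 2) - int (4 * p ^ 2 + 2 * p - 2)" and r_s: "r - s = 4 * int p"
    unfolding int_l int_k by (auto simp: r_def s_def algebra_simps power2_eq_square)
  have odd_p: "odd p" using p prime_odd_nat by auto
  have cop8: "coprime 8 p"
    using coprime_power_left_iff[of 2 3 p] odd_p by simp
  obtain K where Syl2: "subgroup K G" "card K = 8"
    using sylow_thm[OF two_is_prime_nat is_group, of 3 "p ^ 3"] ord fin by auto
  obtain P where Sylp: "subgroup P G" "card P = p ^ 3"
    using sylow_thm[OF p(1) is_group, of 3 8] ord fin by (auto simp: mult.commute)
  interpret coprime_factorization G K P
    by (intro coprime_factorization.intro coprime_factorization_axioms.intro)
      (use \<open>comm_group G\<close> fin Syl2 Sylp ord cop8 in simp_all)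
  \<comment> \<open>Powers by \<open>u\<close> fix \<open>K\<close> pointwise and have order
    \<open>p - 1\<close> on \<open>P\<close>.\<close>
  obtain u where u: "[u = 1] (mod 8)" "[u ^ (p - 1) = 1] (mod 8 * p ^ 3)"
      "\<And>i. [u ^ i = 1] (mod p) \<Longrightarrow> p - 1 dvd i"
    using teichmueller_exponent[OF p(1) cop8, of 2] by (metis eval_nat_numeral(3) numeral_2_eq_2)
  have cop_u: "coprime u (8 * p ^ 3)"
  proof -
    have "coprime (u ^ (p - 1)) (8 * p ^ 3)"
      using u(2) by (metis cong_imp_coprime cong_sym coprime_1_left)
    then show ?thesis using p(2) by simp
  qed
  have "8 * p ^ 3 = 4 * p * (2 * p ^ 2)" by (simp add: power2_eq_square power3_eq_cube)
  then have "coprime u (4 * p)" using cop_u by (metis coprime_mult_right_iff)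
  then have "coprime (int u) (int (4 * p))" unfolding coprime_int_iff .
  then have "coprime (int u) (r - s)" unfolding r_s by simp
  moreover have "u > 0" using u(1) by (auto simp: cong_def intro: Nat.gr0I)
  ultimately have closed: "d [^]\<^bsub>G\<^esub> u \<in> D" if "d \<in> D" for d
    using regular_pds_multiplier[OF D rs cop_u] that by blast
  have mod_pred: "[int (card (D \<inter> (h <#\<^bsub>G\<^esub> P))) = of_bool (h \<in> D)] (mod int (p - 1))" if "h \<in> K" for h
    using card_coset_cong_pred_prime[OF sub p(1) Sylp(2)] u closed that Syl2(2) ord by simp
  have roots: "[int (card {d \<in> D. d [^]\<^bsub>G\<^esub> p = x}) = r * of_bool (x = \<one>\<^bsub>G\<^esub>)] (mod int p)"
    if "x \<in> carrier G" for x
    by (rule regular_pds_card_prime_roots[OF D rs p(1) _ _ that]) (auto simp: r_s)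
  \<comment> \<open>The coset of \<open>h\<close> is the fibre of the \<open>p ^ 3\<close>-rd power
    map over \<open>h [^] (p ^ 3)\<close>, and that value is the identity only for
    \<open>h = \<one>\<close>.\<close>
  have mod_p: "[int (card (D \<inter> (h <#\<^bsub>G\<^esub> P))) = r * of_bool (h = \<one>\<^bsub>G\<^esub>)] (mod int p)" if h: "h \<in> K" for h
  proof -
    have "D \<inter> (h <#\<^bsub>G\<^esub> P) = {d \<in> D. d [^]\<^bsub>G\<^esub> (p ^ Suc 2) = h [^]\<^bsub>G\<^esub> (p ^ 3)}"
      unfolding l_coset_eq_pow[OF h] Sylp(2) using sub by (auto simp: numeral_3_eq_3)
    moreover have "h [^]\<^bsub>G\<^esub> (p ^ 3) = \<one>\<^bsub>G\<^esub> \<longleftrightarrow> h = \<one>\<^bsub>G\<^esub>"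
      using one_if_coprime_pows[of "p ^ 3" 8 h] cop8 K_sub[OF h] pow_card_K[OF h] Syl2(2)
      by (auto simp: coprime_commute)
    ultimately show ?thesis
      using card_prime_power_roots_cong[OF sub fin roots, of 2 "h [^]\<^bsub>G\<^esub> (p ^ 3)"] by simp
  qed
  \<comment> \<open>Adding 2 at the identity replaces the residue \<open>r\<close> by
    \<open>r + 2 = 2 * p\<close>, so every corrected count is a multiple of
    \<open>p\<close>.\<close>
  have "\<exists>t. int (card (D \<inter> (h <#\<^bsub>G\<^esub> P))) + 2 * of_bool (h = \<one>\<^bsub>G\<^esub>) = int p * t" if "h \<in> K" for h
  proof -
    have "[int (card (D \<inter> (h <#\<^bsub>G\<^esub> P))) + 2 * of_bool (h = \<one>\<^bsub>G\<^esub>)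
        = r * of_bool (h = \<one>\<^bsub>G\<^esub>) + 2 * of_bool (h = \<one>\<^bsub>G\<^esub>)] (mod int p)"
      by (rule cong_add[OF mod_p[OF that] cong_refl])
    also have "r * of_bool (h = \<one>\<^bsub>G\<^esub>) + 2 * of_bool (h = \<one>\<^bsub>G\<^esub>) = int p * (2 * of_bool (h = \<one>\<^bsub>G\<^esub>))"
      by (auto simp: r_def s_def)
    also have "[\<dots> = 0] (mod int p)" by (simp add: cong_0_iff)
    finally show ?thesis by (simp add: cong_0_iff dvd_def)
  qed
  then obtain t where t: "\<And>h. h \<in> K \<Longrightarrow>
      int (card (D \<inter> (h <#\<^bsub>G\<^esub> P))) + 2 * of_bool (h = \<one>\<^bsub>G\<^esub>) = int p * t h" by metis
  let ?m = "\<lambda>h. int (card (D \<inter> (h <#\<^bsub>G\<^esub> P)))"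
  have one_K: "\<one>\<^bsub>G\<^esub> \<in> K" by (rule subgroup.one_closed[OF Syl2(1)])
  have p0: "int p \<noteq> 0" using p(2) by simp
  have delta: "(\<Sum>h\<in>K. f h * of_bool (h = \<one>\<^bsub>G\<^esub>)) = f \<one>\<^bsub>G\<^esub>" for f :: "'a \<Rightarrow> int"
    using finite_K one_K by (simp add: of_bool_def if_distrib cong: if_cong)
  have sum_m: "(\<Sum>h\<in>K. ?m h) = 4 * int p ^ 2 + 2 * int p - 2"
    using card_eq_sum_cosets[OF sub] card_D int_k by simp
  have coset_one: "\<one>\<^bsub>G\<^esub> <#\<^bsub>G\<^esub> P = P" using P_sub by (auto simp: l_coset_def)
  have sum_m2: "(\<Sum>h\<in>K. ?m h ^ 2) = 4 * int p ^ 2 + 2 * int p - 2 - 4 * ?m \<one>\<^bsub>G\<^esub> + (2 * int p + 2) * (int p ^ 3 - 1)"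
    using regular_pds_sum_squares_cosets[OF D] Sylp(2) unfolding int_l int_k coset_one
    by (simp add: algebra_simps)
  have "int p * (\<Sum>h\<in>K. t h) = (\<Sum>h\<in>K. ?m h + 2 * of_bool (h = \<one>\<^bsub>G\<^esub>))"
    by (simp add: sum_distrib_left t)
  also have "\<dots> = int p * (4 * int p + 2)"
    using sum_m delta[of "\<lambda>_. 2"] by (simp add: sum.distrib algebra_simps power2_eq_square)
  finally have sum_t: "(\<Sum>h\<in>K. t h) = 4 * int p + 2" using p0 by simp
  have "int p ^ 2 * (\<Sum>h\<in>K. t h ^ 2) = (\<Sum>h\<in>K. (?m h + 2 * of_bool (h = \<one>\<^bsub>G\<^esub>)) ^ 2)"
    by (simp add: sum_distrib_left t power_mult_distrib)
  \<comment> \<open>The cross term \<open>4 * ?m \<one>\<close> will cancel the contribution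
    \<open>l - m = -4\<close> per element of \<open>D \<inter> P\<close>, so the total no longer
    depends on \<open>D\<close>.\<close>
  also have "\<dots> = (\<Sum>h\<in>K. ?m h ^ 2 + (4 * ?m h + 4) * of_bool (h = \<one>\<^bsub>G\<^esub>))"
    by (intro sum.cong) (auto simp: power2_eq_square algebra_simps)
  also have "\<dots> = (\<Sum>h\<in>K. ?m h ^ 2) + (4 * ?m \<one>\<^bsub>G\<^esub> + 4)"
    unfolding sum.distrib delta ..
  also have "\<dots> = int p ^ 2 * (2 * int p ^ 2 + 2 * int p + 4)"
    unfolding sum_m2 by (simp add: algebra_simps power2_eq_square power3_eq_cube)
  finally have sum_t2: "(\<Sum>h\<in>K. t h ^ 2) = 2 * int p ^ 2 + 2 * int p + 4" using p0 by simp
  have t_mod: "[t h = of_bool (h \<in> D) + 2 * of_bool (h = \<one>\<^bsub>G\<^esub>)] (mod int (p - 1))" if h: "h \<in> K" for h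
  proof -
    \<comment> \<open>Since \<open>p\<close> is 1 modulo \<open>p - 1\<close>, the number
      \<open>t h\<close> has the same residue as \<open>p * t h\<close>.\<close>
    have "1 - int p = - int (p - 1)" using p(2) by simp
    then have "[1 = int p] (mod int (p - 1))" unfolding cong_iff_dvd_diff by (metis dvd_minus_iff dvd_refl)
    then have "[1 * t h = int p * t h] (mod int (p - 1))" by (rule cong_mult[OF _ cong_refl])
    also have "int p * t h = ?m h + 2 * of_bool (h = \<one>\<^bsub>G\<^esub>)" using t[OF h] by simp
    also have "[\<dots> = of_bool (h \<in> D) + 2 * of_bool (h = \<one>\<^bsub>G\<^esub>)] (mod int (p - 1))"
      by (rule cong_add[OF mod_pred[OF h] cong_refl])
    finally show ?thesis by simp
  qed
  show False
  proof (rule no_coset_profile[OF p finite_K Syl2(2) one_K sum_t sum_t2])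
    show "[t \<one>\<^bsub>G\<^esub> = 2] (mod int (p - 1))" using t_mod[OF one_K] one by simp
    show "[t h = 0] (mod int (p - 1)) \<or> [t h = 1] (mod int (p - 1))" if "h \<in> K" "h \<noteq> \<one>\<^bsub>G\<^esub>" for h
      using t_mod[OF that(1)] that(2) by (cases "h \<in> D") auto
  qed
qed

end
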